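(* Let $A$ be a coherent $PF$-quantale. Then an element $a\in A$ is pure if and only if $a=\bigwedge(\mathrm{Min}(A)\cap E)$ for some closed subset $E$ of $\mathrm{Spec}_F(A)$.
   Context: A quantale is a complete lattice $(A,\vee,\wedge,0,1)$ with an associative multiplication distributing over arbitrary joins in each variable. All quantales are assumed commutative and integral ($1$ is the multiplicative unit). $K(A)$ is the set of compact elements. $A$ is algebraic if every element is a join of compact elements; $A$ is coherent if it is algebraic, $1\in K(A)$ and $K(A)$ is closed under multiplication. $a^{\perp}=\bigvee\{x\in A: ax=0\}$. An element $p<1$ is $m$-prime if $ab\le p$ implies $a\le p$ or $b\le p$; $\mathrm{Spec}(A)$ is the set of $m$-prime elements and $\mathrm{Min}(A)$ the set of minimal elements of $\mathrm{Spec}(A)$. For $c\in A$, $V(c)=\{p\in\mathrm{Spec}(A): c\le p\}$. $\mathrm{Spec}_F(A)$ is $\mathrm{Spec}(A)$ with the flat topology, which has $\{V(c): c\in K(A)\}$ as a basis of open sets. An element $a$ is pure if for all $c\in K(A)$, $c\le a$ implies $a\vee c^{\perp}=1$. $A$ is a $PF$-quantale if $c^{\perp}$ is pure for every $c\in K(A)$. The meet of the empty set is $1$. *)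

theory Defs
  imports "HOL-Analysis.Abstract_Topology"
begin

text \<open>All quantales are commutative and integral. The least element \<open>0\<close> of the quantale
  is \<open>bot\<close>; the unit \<open>1\<close> is identified with the greatest element \<open>top\<close>.\<close>

class quantale = complete_lattice + comm_monoid_mult +
  assumes mult_Sup: "a * Sup S = Sup ((*) a ` S)"
    and one_eq_top: "1 = top"
begin

definition K :: "'a set" where
  "K = {c. \<forall>S. c \<le> Sup S \<longrightarrow> (\<exists>F\<subseteq>S. finite F \<and> c \<le> Sup F)}"

definition annihilator :: "'a \<Rightarrow> 'a" where
  "annihilator a = Sup {x. a * x = bot}"

definition Spec :: "'a set" where
  "Spec = {p. p < 1 \<and> (\<forall>a b. a * b \<le> p \<longrightarrow> a \<le> p \<or> b \<le> p)}"

definition Min_Spec :: "'a set" where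
  "Min_Spec = {p \<in> Spec. \<forall>q\<in>Spec. q \<le> p \<longrightarrow> q = p}"

definition V :: "'a \<Rightarrow> 'a set" where
  "V c = {p \<in> Spec. c \<le> p}"

text \<open>The lemma \<open>istopology_flat\<close> below shows that the unions of the sets \<open>V c\<close>, for
  \<open>c\<close> compact, do form a topology, so \<open>flat_topology\<close> has these sets as a basis.\<close>

definition flat_topology :: "'a topology" where
  "flat_topology = topology (arbitrary union_of (\<lambda>U. U \<in> V ` K))"

definition pure_element :: "'a \<Rightarrow> bool" where
  "pure_element a \<longleftrightarrow> (\<forall>c\<in>K. c \<le> a \<longrightarrow> sup a (annihilator c) = 1)"

lemma bot_in_K: "bot \<in> K"
  unfolding K_def by (auto intro: exI[of _ "{}"])

lemma sup_in_K:
  assumes "c \<in> K" "d \<in> K"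
  shows "sup c d \<in> K"
  unfolding K_def
proof (intro CollectI allI impI)
  fix S assume "sup c d \<le> Sup S"
  then have "c \<le> Sup S" "d \<le> Sup S" by auto
  then obtain F G where "F \<subseteq> S" "finite F" "c \<le> Sup F" "G \<subseteq> S" "finite G" "d \<le> Sup G"
    using assms unfolding K_def by blast
  then show "\<exists>F\<subseteq>S. finite F \<and> sup c d \<le> Sup F"
    by (intro exI[of _ "F \<union> G"])
      (auto simp: Sup_union_distrib intro: le_supI1 le_supI2)
qed

lemma istopology_flat: "istopology (arbitrary union_of (\<lambda>U. U \<in> V ` K))"
proof (rule istopology_base)
  fix S T assume "S \<in> V ` K" "T \<in> V ` K"
  then obtain c d where "c \<in> K" "d \<in> K" and ST: "S = V c" "T = V d" by blast
  then have "sup c d \<in> K" by (simp add: sup_in_K)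
  moreover have "S \<inter> T = V (sup c d)" unfolding ST V_def by auto
  ultimately show "S \<inter> T \<in> V ` K" by blast
qed

lemma openin_flat_topology:
  "openin flat_topology U \<longleftrightarrow> (\<exists>C\<subseteq>K. U = (\<Union>c\<in>C. V c))"
proof -
  have "openin flat_topology U \<longleftrightarrow> (arbitrary union_of (\<lambda>U. U \<in> V ` K)) U"
    by (simp add: flat_topology_def istopology_flat topology_inverse')
  also have "\<dots> \<longleftrightarrow> (\<exists>\<U>\<subseteq>V ` K. \<Union>\<U> = U)"
    unfolding union_of_def arbitrary_def by blast
  also have "\<dots> \<longleftrightarrow> (\<exists>C\<subseteq>K. U = (\<Union>c\<in>C. V c))"
    unfolding subset_image_iff by blast
  finally show ?thesis .
qed

lemma topspace_flat_topology: "topspace flat_topology = Spec"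
proof
  have "openin flat_topology (topspace flat_topology)" by simp
  then show "topspace flat_topology \<subseteq> Spec"
    unfolding openin_flat_topology V_def by blast
  have "Spec = V bot" by (simp add: V_def)
  then have "openin flat_topology Spec"
    unfolding openin_flat_topology using bot_in_K by (intro exI[of _ "{bot}"]) auto
  then show "Spec \<subseteq> topspace flat_topology" by (rule openin_subset)
qed

end

class algebraic_quantale = quantale +
  assumes algebraic: "\<exists>S\<subseteq>K. a = Sup S"

class coherent_quantale = algebraic_quantale +
  assumes one_in_K: "1 \<in> K"
    and mult_in_K: "c \<in> K \<Longrightarrow> d \<in> K \<Longrightarrow> c * d \<in> K"

class PF_quantale = quantale +
  assumes pure_annihilator: "c \<in> K \<Longrightarrow> pure_element (annihilator c)"

end

theory Submission
  imports Defs
begin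

text \<open>For an \<open>m\<close>-prime \<open>m\<close> let \<open>O(m)\<close> (\<open>prime_core m\<close> below) be the join of all \<open>x\<close>
  annihilated by some \<open>d\<close> with \<open>d \<not>\<le> m\<close>. In a coherent \<open>PF\<close>-quantale \<open>O(m)\<close> is itself \<open>m\<close>-prime, hence the unique
  minimal \<open>m\<close>-prime below \<open>m\<close>, and it is pure. If \<open>E\<close> is flat-closed and
  the meet of the minimal primes in \<open>E\<close> lies below \<open>m\<close>, then \<open>O(m) \<in> E\<close>; purity of \<open>O(m)\<close>
  then yields purity of the meet. Conversely, for pure \<open>a\<close> the set \<open>V a\<close> is flat-closed and
  contains \<open>O(m)\<close> along with \<open>m\<close>, which makes \<open>a\<close> the meet of the minimal primes above it.\<close>

section \<open>Arithmetic of quantales\<close>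

context quantale
begin

lemma mult_sup_distrib: "a * sup x y = sup (a * x) (a * y)"
  using mult_Sup[of a "{x, y}"] by simp

lemma mult_mono_right: "x \<le> y \<Longrightarrow> a * x \<le> a * y"
  using mult_sup_distrib[of a x y] by (simp add: le_iff_sup)

lemma mult_le_left: "a * b \<le> a"
  proof -
  have "b \<le> 1" by (simp add: one_eq_top)
  then show ?thesis using mult_mono_right[of b 1 a] by simp
qed

lemma mult_le_right: "a * b \<le> b"
  using mult_le_left[of b a] by (simp add: mult.commute)

lemma mult_annihilator: "a * annihilator a = bot"
proof -
  have "a * annihilator a = Sup ((*) a ` {x. a * x = bot})"
    by (simp add: annihilator_def mult_Sup)
  also have "\<dots> = bot"
    by (auto intro!: Sup_eqI)
  finally show ?thesis .
qed

lemma le_annihilator_iff: "x \<le> annihilator a \<longleftrightarrow> a * x = bot"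
proof
  assume "x \<le> annihilator a"
  then show "a * x = bot"
    using mult_mono_right[of x "annihilator a" a] by (simp add: mult_annihilator bot_unique)
qed (simp add: annihilator_def Sup_upper)

lemma Spec_neq_one: "p \<in> Spec \<Longrightarrow> p \<noteq> 1"
  by (auto simp: Spec_def)

lemma Spec_multD: "p \<in> Spec \<Longrightarrow> a * b \<le> p \<Longrightarrow> a \<le> p \<or> b \<le> p"
  by (auto simp: Spec_def)

lemma Spec_sup_neq_one: "p \<in> Spec \<Longrightarrow> x \<le> p \<Longrightarrow> y \<le> p \<Longrightarrow> sup x y \<noteq> 1"
  using Spec_neq_one[of p] one_eq_top by (metis le_sup_iff top.extremum_unique)

lemma Spec_annihilated_le:
  assumes "p \<in> Spec" "a * b = bot" "\<not> b \<le> p"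
  shows "a \<le> p"
  using Spec_multD[of p a b] assms by simp

text \<open>Compactness first yields a finite subset of \<open>X\<close>; induction folds it into
  one bound, and \<open>X \<noteq> {}\<close> covers the empty subset.\<close>

lemma compact_le_Sup_directed:
  assumes "c \<in> K" "c \<le> Sup X" "X \<noteq> {}"
    and directed: "\<And>x y. x \<in> X \<Longrightarrow> y \<in> X \<Longrightarrow> \<exists>z\<in>X. x \<le> z \<and> y \<le> z"
  obtains x where "x \<in> X" "c \<le> x"
proof -
  obtain F where F: "finite F" "F \<subseteq> X" "c \<le> Sup F"
    using assms(1,2) unfolding K_def by blast
  from F(1,2) have "\<exists>z\<in>X. Sup F \<le> z"
  proof induction
    case empty
    then show ?case using assms(3) by auto
  next
    case (insert x F)
    then obtain z where "z \<in> X" "Sup F \<le> z" by blast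
    with insert.prems directed[of x z] show ?case
      by (auto intro: order_trans)
  qed
  with F(3) show thesis
    by (blast intro: that order_trans)
qed

section \<open>The core of a prime\<close>

text \<open>Quantale form of the kernel of the localization of a ring at a prime ideal.\<close>

definition prime_core :: "'a \<Rightarrow> 'a" where
  "prime_core p = Sup {x. \<exists>d. \<not> d \<le> p \<and> x * d = bot}"

lemma prime_core_upper: "\<not> d \<le> p \<Longrightarrow> x * d = bot \<Longrightarrow> x \<le> prime_core p"
  unfolding prime_core_def by (rule Sup_upper) blast

text \<open>The elements joined in \<open>prime_core p\<close> form a directed set: the product of
  two annihilating elements annihilates the join, and primality keeps it from falling below
  \<open>p\<close>. So compactness selects a single one of them.\<close>

lemma compact_le_prime_coreD:
  assumes "p \<in> Spec" "c \<in> K" "c \<le> prime_core p"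
  obtains d where "\<not> d \<le> p" "c * d = bot"
proof -
  let ?X = "{x. \<exists>d. \<not> d \<le> p \<and> x * d = bot}"
  have "bot * 1 = bot" by simp
  moreover have "\<not> 1 \<le> p"
    using Spec_neq_one[OF assms(1)] by (simp add: one_eq_top top_unique)
  ultimately have "?X \<noteq> {}" by blast
  moreover have "\<exists>z\<in>?X. x \<le> z \<and> y \<le> z" if xy: "x \<in> ?X" "y \<in> ?X" for x y
  proof -
    obtain d where d: "\<not> d \<le> p" "x * d = bot"
      using xy(1) by blast
    obtain e where e: "\<not> e \<le> p" "y * e = bot"
      using xy(2) by blast
    have "x * (d * e) = bot" "y * (d * e) = bot"
      using d e mult_mono_right[OF mult_le_left[of d e], of x]
        mult_mono_right[OF mult_le_right[of d e], of y] by (simp_all add: bot_unique)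
    then have "sup x y * (d * e) = bot"
      using mult_sup_distrib[of "d * e" x y] by (simp add: mult.commute)
    moreover have "\<not> d * e \<le> p"
      using d e Spec_multD[OF assms(1)] by blast
    ultimately show ?thesis
      by (intro bexI[of _ "sup x y"]) auto
  qed
  ultimately obtain x where x: "x \<in> ?X" "c \<le> x"
    using compact_le_Sup_directed[OF assms(2), of ?X] assms(3) unfolding prime_core_def by blast
  then obtain d where d: "\<not> d \<le> p" "x * d = bot" by blast
  have "c * d = bot"
    using mult_mono_right[OF x(2), of d] d(2) by (simp add: mult.commute bot_unique)
  with d(1) show thesis by (rule that)
qed

text \<open>An element \<open>d\<close> not below \<open>p\<close> is not below \<open>q\<close>
  either, so \<open>x * d = bot\<close> forces \<open>x\<close> under the prime
  \<open>q\<close>.\<close>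

lemma prime_core_least:
  assumes "q \<in> Spec" "q \<le> p"
  shows "prime_core p \<le> q"
  unfolding prime_core_def
proof (rule Sup_least)
  fix x assume "x \<in> {x. \<exists>d. \<not> d \<le> p \<and> x * d = bot}"
  then obtain d where "\<not> d \<le> p" "x * d = bot" by blast
  then show "x \<le> q"
    using Spec_annihilated_le assms order_trans by blast
qed

text \<open>Purity makes \<open>annihilator c\<close> the witness: it cannot lie below
  \<open>p\<close> together with \<open>a\<close>, since their join is 1.\<close>

lemma le_prime_core_of_pure_compact:
  assumes "p \<in> Spec" "pure_element a" "a \<le> p" "c \<in> K" "c \<le> a"
  shows "c \<le> prime_core p"
proof (rule prime_core_upper)
  have "sup a (annihilator c) = 1"
    using assms unfolding pure_element_def by blast
  then show "\<not> annihilator c \<le> p"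
    using Spec_sup_neq_one[OF assms(1,3)] by blast
qed (rule mult_annihilator)

lemma maximal_in_Spec:
  assumes "m \<noteq> 1" and max: "\<And>y. m \<le> y \<Longrightarrow> y \<noteq> 1 \<Longrightarrow> y = m"
  shows "m \<in> Spec"
  unfolding Spec_def
proof (intro CollectI conjI allI impI)
  show "m < 1"
    using assms(1) one_eq_top top.not_eq_extremum by simp
  fix a b assume ab: "a * b \<le> m"
  show "a \<le> m \<or> b \<le> m"
  proof (rule ccontr)
    assume "\<not> (a \<le> m \<or> b \<le> m)"
    then have 1: "sup m a = 1" "sup m b = 1"
      using max[of "sup m a"] max[of "sup m b"] by (metis sup_ge1 sup_ge2)+
    \<comment> \<open>Since \<open>sup m b\<close> is 1, this product is \<open>a\<close>
      itself.\<close>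
    have "a * sup m b \<le> m"
      using ab mult_le_right[of a m] by (simp add: mult_sup_distrib)
    then have "a \<le> m" using 1 by simp
    then show False using \<open>\<not> (a \<le> m \<or> b \<le> m)\<close> by blast
  qed
qed

end

section \<open>Coherent quantales\<close>

lemma (in algebraic_quantale) le_if_compacts_le:
  assumes "\<And>c. c \<in> K \<Longrightarrow> c \<le> a \<Longrightarrow> c \<le> b"
  shows "a \<le> b"
proof -
  obtain S where S: "S \<subseteq> K" "a = Sup S" using algebraic by blast
  show ?thesis
    unfolding S(2)
  proof (rule Sup_least)
    fix x assume "x \<in> S"
    then show "x \<le> b" using S assms Sup_upper[of x S] by blast
  qed
qed

context coherent_quantale
begin

text \<open>Zorn's lemma on the proper elements above \<open>x\<close>: compactness of 1 keeps the
  join of a nonempty chain proper, and a maximal proper element is prime.\<close>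

lemma ex_Spec_above:
  assumes "x \<noteq> 1"
  obtains m where "m \<in> Spec" "x \<le> m"
proof -
  let ?A = "{y. x \<le> y \<and> y \<noteq> 1}"
  have "\<exists>m\<in>?A. \<forall>y\<in>?A. m \<le> y \<longrightarrow> y = m"
  proof (rule predicate_Zorn)
    show "partial_order_on ?A (relation_of (\<le>) ?A)"
      by (rule partial_order_on_relation_ofI) auto
    fix C assume C: "C \<in> Chains (relation_of (\<le>) ?A)"
    then have CA: "C \<subseteq> ?A" and total: "\<And>u v. u \<in> C \<Longrightarrow> v \<in> C \<Longrightarrow> u \<le> v \<or> v \<le> u"
      unfolding Chains_def relation_of_def by blast+
    show "\<exists>u\<in>?A. \<forall>y\<in>C. y \<le> u"
    proof (cases "C = {}")
      case True
      then show ?thesis using assms by blast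
    next
      case False
      have "Sup C \<noteq> 1"
      proof
        assume "Sup C = 1"
        then obtain y where y: "y \<in> C" "1 \<le> y"
          using compact_le_Sup_directed[OF one_in_K, of C] False total by (metis order_refl)
        then show False
          using CA by (auto simp: one_eq_top top_unique)
      qed
      moreover obtain y where "y \<in> C" "x \<le> y"
        using False CA by blast
      then have "x \<le> Sup C"
        by (rule Sup_upper2)
      ultimately show ?thesis
        by (auto intro!: exI[of _ "Sup C"] simp: Sup_upper)
    qed
  qed
  then obtain m where m: "x \<le> m" "m \<noteq> 1" "\<And>y. x \<le> y \<Longrightarrow> y \<noteq> 1 \<Longrightarrow> m \<le> y \<Longrightarrow> y = m"
    by blast
  have "m \<in> Spec"
  proof (rule maximal_in_Spec[OF m(2)])
    fix y assume "m \<le> y" "y \<noteq> 1"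
    then show "y = m" using m(3) order_trans[OF m(1)] by simp
  qed
  then show thesis using m(1) by (rule that)
qed

lemma le_prime_core_of_pure:
  assumes "p \<in> Spec" "pure_element a" "a \<le> p"
  shows "a \<le> prime_core p"
  using le_prime_core_of_pure_compact[OF assms] by (rule le_if_compacts_le)

text \<open>The complement is the union of \<open>V d\<close> over the compact \<open>d\<close>
  comaximal with \<open>a\<close>; purity supplies enough such \<open>d\<close>.\<close>

lemma closedin_flat_V_of_pure:
  assumes "pure_element a"
  shows "closedin flat_topology (V a)"
proof -
  let ?C = "{d \<in> K. sup a d = 1}"
  have "a \<le> p" if p: "p \<in> Spec" and "\<forall>d\<in>?C. \<not> d \<le> p" for p
  proof (rule le_if_compacts_le)
    fix c assume c: "c \<in> K" "c \<le> a"
    \<comment> \<open>The joins of \<open>a\<close> with compact elements below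
      \<open>annihilator c\<close> are directed with join 1, so compactness of 1 lets a single
      compact \<open>d\<close> replace \<open>annihilator c\<close>.\<close>
    let ?D = "{d \<in> K. d \<le> annihilator c}"
    let ?X = "sup a ` ?D"
    have "sup a (annihilator c) \<le> Sup ?X"
    proof (rule sup_least)
      have "sup a bot \<in> ?X" by (rule imageI) (simp add: bot_in_K)
      then show "a \<le> Sup ?X" by (rule Sup_upper2) simp
      show "annihilator c \<le> Sup ?X"
      proof (rule le_if_compacts_le)
        fix d assume "d \<in> K" "d \<le> annihilator c"
        then have "sup a d \<in> ?X" by simp
        then show "d \<le> Sup ?X" by (rule Sup_upper2) simp
      qed
    qed
    moreover have "sup a (annihilator c) = 1"
      using assms c by (simp add: pure_element_def)
    ultimately have "1 \<le> Sup ?X" by metis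
    moreover have "bot \<in> ?D" by (simp add: bot_in_K)
    then have "?X \<noteq> {}" unfolding image_is_empty by (metis empty_iff)
    moreover have "\<exists>z\<in>?X. u \<le> z \<and> v \<le> z" if uv: "u \<in> ?X" "v \<in> ?X" for u v
    proof -
      obtain d where d: "d \<in> ?D" "u = sup a d" using uv(1) by (rule imageE)
      obtain e where e: "e \<in> ?D" "v = sup a e" using uv(2) by (rule imageE)
      have "sup d e \<in> ?D" using d(1) e(1) sup_in_K by simp
      then have "sup a (sup d e) \<in> ?X" by (rule imageI)
      then show ?thesis
        unfolding d(2) e(2) by (rule bexI[rotated]) (auto intro: le_supI2 le_supI1)
    qed
    ultimately obtain y where "y \<in> ?X" "1 \<le> y"
      by (rule compact_le_Sup_directed[OF one_in_K])
    then obtain d where d: "d \<in> K" "d \<le> annihilator c" "sup a d = 1"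
      by (auto simp: one_eq_top top_unique)
    then show "c \<le> p"
      using that Spec_annihilated_le[OF p, of c d] by (simp add: le_annihilator_iff)
  qed
  moreover have "\<not> d \<le> p" if "p \<in> Spec" "a \<le> p" "sup a d = 1" for p d
    using Spec_sup_neq_one that by blast
  ultimately have "Spec - V a = (\<Union>d\<in>?C. V d)"
    unfolding V_def by auto
  then have "openin flat_topology (Spec - V a)"
    unfolding openin_flat_topology by (intro exI[of _ ?C]) simp
  moreover have "V a \<subseteq> Spec" by (auto simp: V_def)
  ultimately show ?thesis
    by (simp add: closedin_def topspace_flat_topology)
qed

end

section \<open>Minimal primes of coherent PF-quantales\<close>

text \<open>By algebraicity compact factors suffice. If \<open>c * d * e = bot\<close>, the PF
  condition splits 1 into two annihilators, not both below \<open>p\<close>; one that is not below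
  \<open>p\<close> yields a witness for \<open>c\<close> or for \<open>d\<close>.\<close>

lemma prime_core_in_Spec:
  fixes p :: "'a :: {coherent_quantale, PF_quantale}"
  assumes p: "p \<in> Spec"
  shows "prime_core p \<in> Spec"
proof -
  have compact_prime: "c \<le> prime_core p \<or> d \<le> prime_core p"
    if cd: "c \<in> K" "d \<in> K" "c * d \<le> prime_core p" for c d :: 'a
  proof -
    obtain e where e: "\<not> e \<le> p" "c * d * e = bot"
      using compact_le_prime_coreD[OF p mult_in_K] cd by blast
    \<comment> \<open>A compact \<open>e'\<close> makes \<open>d * e'\<close> compact, as purity of
      \<open>annihilator c\<close> requires.\<close>
    obtain e' where e': "e' \<in> K" "e' \<le> e" "\<not> e' \<le> p"
      using e(1) le_if_compacts_le by blast
    have "c * (d * e') = bot"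
      using e(2) mult_mono_right[OF e'(2), of "c * d"] by (simp add: bot_unique mult.assoc)
    then have "sup (annihilator c) (annihilator (d * e')) = 1"
      using pure_annihilator[of c] mult_in_K[of d e'] cd e'
      unfolding pure_element_def by (simp add: le_annihilator_iff)
    then consider "\<not> annihilator c \<le> p" | "\<not> annihilator (d * e') \<le> p"
      using Spec_sup_neq_one[OF p] by blast
    then show ?thesis
    proof cases
      case 1
      then show ?thesis using prime_core_upper mult_annihilator by blast
    next
      case 2
      \<comment> \<open>Neither factor is below \<open>p\<close>, so this product witnesses
        \<open>d \<le> prime_core p\<close>.\<close>
      then have "\<not> e' * annihilator (d * e') \<le> p"
        using Spec_multD[OF p] e' by blast
      moreover have "d * (e' * annihilator (d * e')) = bot"
        using mult_annihilator[of "d * e'"] by (simp add: mult.assoc)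
      ultimately show ?thesis using prime_core_upper by blast
    qed
  qed
  have "prime_core p < 1"
    using prime_core_least[OF p order_refl] p by (auto simp: Spec_def)
  moreover have "a \<le> prime_core p \<or> b \<le> prime_core p" if ab: "a * b \<le> prime_core p" for a b
  proof (rule ccontr)
    assume "\<not> ?thesis"
    then obtain c d where cd: "c \<in> K" "c \<le> a" "\<not> c \<le> prime_core p"
      "d \<in> K" "d \<le> b" "\<not> d \<le> prime_core p"
      using le_if_compacts_le by metis
    have "c * d \<le> a * b"
      using cd mult_mono_right[of d b c] mult_mono_right[of c a b]
      by (simp add: mult.commute order_trans)
    with ab cd compact_prime show False
      by (meson order_trans)
  qed
  ultimately show ?thesis by (simp add: Spec_def)
qed

lemma prime_core_in_Min_Spec:
  fixes p :: "'a :: {coherent_quantale, PF_quantale}"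
  assumes p: "p \<in> Spec"
  shows "prime_core p \<in> Min_Spec"
  unfolding Min_Spec_def
  using prime_core_in_Spec[OF p] prime_core_least[of _ p] prime_core_least[OF p order_refl]
  by (auto intro: antisym order_trans)

text \<open>A compact \<open>d'\<close> not below \<open>p\<close> with \<open>c * d' = bot\<close>
  lies below the pure \<open>annihilator c\<close>, so 1 splits into \<open>annihilator c\<close>
  and \<open>annihilator d'\<close>; the latter lies below the core.\<close>

lemma pure_prime_core:
  fixes p :: "'a :: {coherent_quantale, PF_quantale}"
  assumes p: "p \<in> Spec"
  shows "pure_element (prime_core p)"
  unfolding pure_element_def
proof (intro ballI impI)
  fix c assume c: "c \<in> K" "c \<le> prime_core p"
  obtain d where d: "\<not> d \<le> p" "c * d = bot"
    using compact_le_prime_coreD[OF p c] by blast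
  obtain d' where d': "d' \<in> K" "d' \<le> d" "\<not> d' \<le> p"
    using d(1) le_if_compacts_le by blast
  have "d' \<le> annihilator c"
    using d(2) d'(2) le_annihilator_iff order_trans by blast
  then have 1: "sup (annihilator c) (annihilator d') = 1"
    using pure_annihilator[OF c(1)] d'(1) by (simp add: pure_element_def)
  have "annihilator d' \<le> prime_core p"
    by (rule prime_core_upper[OF d'(3)]) (simp add: mult_annihilator mult.commute)
  then have "1 \<le> sup (prime_core p) (annihilator c)"
    using 1 by (metis sup.commute sup.mono order_refl)
  then show "sup (prime_core p) (annihilator c) = 1"
    by (simp add: one_eq_top top_unique)
qed

lemma Inf_Min_Spec_above_pure:
  fixes a :: "'a :: {coherent_quantale, PF_quantale}"
  assumes "pure_element a"
  shows "Inf (Min_Spec \<inter> V a) = a"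
proof (rule antisym)
  show "a \<le> Inf (Min_Spec \<inter> V a)"
    by (rule Inf_greatest) (simp add: V_def)
  show "Inf (Min_Spec \<inter> V a) \<le> a"
  proof (rule le_if_compacts_le)
    fix c :: 'a assume c: "c \<in> K" "c \<le> Inf (Min_Spec \<inter> V a)"
    \<comment> \<open>The residual of \<open>a\<close> by \<open>c\<close>: it is 1 exactly when
      \<open>c \<le> a\<close>, so a prime above it is to be refuted.\<close>
    let ?r = "Sup {x. c * x \<le> a}"
    have "?r = 1"
    proof (rule ccontr)
      assume "?r \<noteq> 1"
      then obtain m where m: "m \<in> Spec" "?r \<le> m" by (rule ex_Spec_above)
      have "a \<le> ?r" by (rule Sup_upper) (simp add: mult_le_right)
      then have "a \<le> m" using m(2) by (rule order_trans)
      then have "prime_core m \<in> Min_Spec \<inter> V a"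
        using le_prime_core_of_pure[OF m(1) assms] prime_core_in_Min_Spec[OF m(1)]
          prime_core_in_Spec[OF m(1)] by (simp add: V_def)
      then have "c \<le> prime_core m" using c(2) 
        by (meson Inf_lower order_trans)
      then obtain d where "\<not> d \<le> m" "c * d = bot"
        using compact_le_prime_coreD[OF m(1) c(1)] by blast
      moreover from this have "d \<le> ?r" by (intro Sup_upper) simp
      ultimately show False using m(2) order_trans by blast
    qed
    moreover have "c * ?r \<le> a"
      unfolding mult_Sup by (rule Sup_least) auto
    ultimately show "c \<le> a" by simp
  qed
qed

text \<open>Failure at \<open>c\<close> gives a prime \<open>m\<close> above the meet and
  \<open>annihilator c\<close>. Once the meet is shown to lie below \<open>prime_core m\<close>, so
  does \<open>c\<close>, and purity of the core keeps \<open>annihilator c\<close> from lying below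
  \<open>m\<close>.\<close>

lemma pure_Inf_Min_Spec_closed:
  fixes E :: "'a :: {coherent_quantale, PF_quantale} set"
  assumes "closedin flat_topology E"
  shows "pure_element (Inf (Min_Spec \<inter> E))"
  unfolding pure_element_def
proof (intro ballI impI, rule ccontr)
  let ?a = "Inf (Min_Spec \<inter> E)"
  fix c assume c: "c \<in> K" "c \<le> ?a" and "sup ?a (annihilator c) \<noteq> 1"
  then obtain m where m: "m \<in> Spec" "?a \<le> m" "annihilator c \<le> m"
    using ex_Spec_above by (metis le_sup_iff)
  have core_le: "prime_core m \<le> m"
    using m(1) by (intro prime_core_least order_refl)
  have separated: "\<not> annihilator e \<le> m" if "e \<in> K" "e \<le> prime_core m" for e
    using pure_prime_core[OF m(1)] that Spec_sup_neq_one[OF m(1) core_le]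
    unfolding pure_element_def by blast
  obtain C where C: "C \<subseteq> K" "Spec - E = (\<Union>e\<in>C. V e)"
    using assms unfolding closedin_def topspace_flat_topology openin_flat_topology by blast
  have "prime_core m \<in> E"
  proof (rule ccontr)
    assume "prime_core m \<notin> E"
    then obtain e where e: "e \<in> C" "e \<le> prime_core m"
      using C(2) prime_core_in_Spec[OF m(1)] unfolding V_def by blast
    \<comment> \<open>\<open>V e\<close> misses \<open>E\<close>, so no prime in \<open>E\<close>
      lies above \<open>e\<close>, and each must lie above \<open>annihilator e\<close>.\<close>
    have "annihilator e \<le> ?a"
    proof (rule Inf_greatest)
      fix p assume p: "p \<in> Min_Spec \<inter> E"
      then have "p \<in> Spec" "\<not> e \<le> p"
        using C(2) e(1) unfolding Min_Spec_def V_def by blast+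
      then show "annihilator e \<le> p"
        using Spec_annihilated_le[of p "annihilator e" e]
        by (simp add: mult_annihilator mult.commute)
    qed
    then show False
      using separated C(1) e m(2) order_trans by blast
  qed
  then have "?a \<le> prime_core m"
    using prime_core_in_Min_Spec[OF m(1)] by (intro Inf_lower) blast
  then show False
    using separated c m(3) order_trans by blast
qed

theorem theorem6p10:
  fixes a :: "'a :: {coherent_quantale, PF_quantale}"
  shows "pure_element a \<longleftrightarrow>
    (\<exists>E. closedin flat_topology E \<and> a = Inf (Min_Spec \<inter> E))"
  using closedin_flat_V_of_pure Inf_Min_Spec_above_pure pure_Inf_Min_Spec_closed by metis

end
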